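(* Let $\Omega\subset\mathbb{C}$ be a nonempty domain. The set of all functions $f\in\mathcal{H}ol(\Omega)$ with the property that $\widetilde{T}_N(f)$ is unbounded on $\Omega$ for all integers $N\ge 0$ is a dense $G_\delta$ set in $\mathcal{H}ol(\Omega)$.
   Context: A domain is an open connected subset of $\mathbb{C}$. $\mathcal{H}ol(\Omega)$ is the space of all holomorphic functions on $\Omega$ with the topology of uniform convergence on compact subsets of $\Omega$. A $G_\delta$ set is a countable intersection of open sets. For $N\ge 0$, the operator $\widetilde{T}_N:\mathcal{H}ol(\Omega)\to\mathcal{H}ol(\Omega)$ is defined by $\widetilde{T}_N(f)(\zeta)=\sum_{n=0}^{N}\frac{f^{(n)}(\zeta)}{n!}(-\zeta)^n$ for $\zeta\in\Omega$ (the $N$-th Taylor partial sum of $f$ with center $\zeta$, evaluated at $0$). *)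

theory Defs
  imports "HOL-Complex_Analysis.Complex_Analysis"
begin

text \<open>
  A function on \<open>\<Omega>\<close> is represented by its unique extension to \<open>complex\<close> that is
  \<open>undefined\<close> outside \<open>\<Omega>\<close>, so that equality of elements of \<open>Hol \<Omega>\<close> is equality on \<open>\<Omega>\<close>.
\<close>

definition Hol :: "complex set \<Rightarrow> (complex \<Rightarrow> complex) set" where
  "Hol \<Omega> = {f. f holomorphic_on \<Omega> \<and> f \<in> extensional \<Omega>}"

definition Hol_open :: "complex set \<Rightarrow> (complex \<Rightarrow> complex) set \<Rightarrow> bool" where
  "Hol_open \<Omega> U \<longleftrightarrow> U \<subseteq> Hol \<Omega> \<and>
     (\<forall>f\<in>U. \<exists>K e. compact K \<and> K \<subseteq> \<Omega> \<and> e > 0 \<and>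
        {g \<in> Hol \<Omega>. \<forall>z\<in>K. dist (g z) (f z) < e} \<subseteq> U)"

definition Hol_topology :: "complex set \<Rightarrow> (complex \<Rightarrow> complex) topology" where
  "Hol_topology \<Omega> = topology (Hol_open \<Omega>)"

definition T_tilde :: "complex set \<Rightarrow> nat \<Rightarrow> (complex \<Rightarrow> complex) \<Rightarrow> complex \<Rightarrow> complex" where
  "T_tilde \<Omega> N f = (\<lambda>\<zeta>\<in>\<Omega>. \<Sum>n=0..N. (deriv ^^ n) f \<zeta> / fact n * (- \<zeta>) ^ n)"

lemma Hol_openD:
  assumes "Hol_open \<Omega> U" "f \<in> U"
  shows "\<exists>K e. compact K \<and> K \<subseteq> \<Omega> \<and> e > 0 \<and>
    (\<forall>g \<in> Hol \<Omega>. (\<forall>z\<in>K. dist (g z) (f z) < e) \<longrightarrow> g \<in> U)"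
  using assms unfolding Hol_open_def by fast

lemma Hol_openI:
  assumes "U \<subseteq> Hol \<Omega>"
    and "\<And>f. f \<in> U \<Longrightarrow> \<exists>K e. compact K \<and> K \<subseteq> \<Omega> \<and> e > 0 \<and>
        (\<forall>g \<in> Hol \<Omega>. (\<forall>z\<in>K. dist (g z) (f z) < e) \<longrightarrow> g \<in> U)"
  shows "Hol_open \<Omega> U"
  unfolding Hol_open_def
proof (intro conjI ballI)
  fix f assume "f \<in> U"
  from assms(2)[OF this] obtain K e where K: "compact K" "K \<subseteq> \<Omega>" "e > 0"
      "\<forall>g \<in> Hol \<Omega>. (\<forall>z\<in>K. dist (g z) (f z) < e) \<longrightarrow> g \<in> U"
    by (elim exE conjE)
  show "\<exists>K e. compact K \<and> K \<subseteq> \<Omega> \<and> e > 0 \<and>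
        {g \<in> Hol \<Omega>. \<forall>z\<in>K. dist (g z) (f z) < e} \<subseteq> U"
    by (rule exI[of _ K], rule exI[of _ e]) (use K in auto)
qed (rule assms(1))

lemma istopology_Hol_open: "istopology (Hol_open \<Omega>)"
  unfolding istopology_def
proof (intro conjI allI impI)
  fix S T assume S: "Hol_open \<Omega> S" and T: "Hol_open \<Omega> T"
  show "Hol_open \<Omega> (S \<inter> T)"
  proof (rule Hol_openI)
    show "S \<inter> T \<subseteq> Hol \<Omega>" using S by (auto simp: Hol_open_def)
    fix f assume f: "f \<in> S \<inter> T"
    obtain K d where K: "compact K" "K \<subseteq> \<Omega>" "d > 0"
        "\<forall>g \<in> Hol \<Omega>. (\<forall>z\<in>K. dist (g z) (f z) < d) \<longrightarrow> g \<in> S"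
      using Hol_openD[OF S IntD1[OF f]] by (elim exE conjE)
    obtain L e where L: "compact L" "L \<subseteq> \<Omega>" "e > 0"
        "\<forall>g \<in> Hol \<Omega>. (\<forall>z\<in>L. dist (g z) (f z) < e) \<longrightarrow> g \<in> T"
      using Hol_openD[OF T IntD2[OF f]] by (elim exE conjE)
    have "compact (K \<union> L)" "K \<union> L \<subseteq> \<Omega>" "min d e > 0"
      using K(1-3) L(1-3) by auto
    then show "\<exists>K e. compact K \<and> K \<subseteq> \<Omega> \<and> e > 0 \<and>
        (\<forall>g \<in> Hol \<Omega>. (\<forall>z\<in>K. dist (g z) (f z) < e) \<longrightarrow> g \<in> S \<inter> T)"
      by (intro exI[of _ "K \<union> L"] exI[of _ "min d e"] conjI ballI impI IntI
          K(4)[rule_format] L(4)[rule_format]) simp_all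
  qed
next
  fix \<K> assume \<K>: "\<forall>S\<in>\<K>. Hol_open \<Omega> S"
  show "Hol_open \<Omega> (\<Union>\<K>)"
  proof (rule Hol_openI)
    show "\<Union>\<K> \<subseteq> Hol \<Omega>" using \<K> by (auto simp: Hol_open_def)
    fix f assume "f \<in> \<Union>\<K>"
    then obtain S where S: "S \<in> \<K>" "f \<in> S" by blast
    obtain K e where K: "compact K" "K \<subseteq> \<Omega>" "e > 0"
        "\<forall>g \<in> Hol \<Omega>. (\<forall>z\<in>K. dist (g z) (f z) < e) \<longrightarrow> g \<in> S"
      using Hol_openD[OF bspec[OF \<K> S(1)] S(2)] by (elim exE conjE)
    show "\<exists>K e. compact K \<and> K \<subseteq> \<Omega> \<and> e > 0 \<and>
        (\<forall>g \<in> Hol \<Omega>. (\<forall>z\<in>K. dist (g z) (f z) < e) \<longrightarrow> g \<in> \<Union>\<K>)"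
      by (intro exI[of _ K] exI[of _ e] conjI ballI impI UnionI[OF S(1)]
          K(1-3) K(4)[rule_format]) simp_all
  qed
qed

lemma openin_Hol_topology: "openin (Hol_topology \<Omega>) = Hol_open \<Omega>"
  by (simp add: Hol_topology_def istopology_Hol_open)

lemma topspace_Hol_topology [simp]: "topspace (Hol_topology \<Omega>) = Hol \<Omega>"
proof
  show "topspace (Hol_topology \<Omega>) \<subseteq> Hol \<Omega>"
    by (auto simp: topspace_def openin_Hol_topology Hol_open_def)
  have "Hol_open \<Omega> (Hol \<Omega>)"
    by (rule Hol_openI, simp, rule exI[of _ "{}"], rule exI[of _ 1]) simp
  then show "Hol \<Omega> \<subseteq> topspace (Hol_topology \<Omega>)"
    by (simp add: openin_Hol_topology openin_subset)
qed

lemma limitin_Hol_topology: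
  "limitin (Hol_topology \<Omega>) f l F \<longleftrightarrow>
     l \<in> Hol \<Omega> \<and> (\<forall>\<^sub>F x in F. f x \<in> Hol \<Omega>) \<and>
     (\<forall>K. compact K \<and> K \<subseteq> \<Omega> \<longrightarrow> uniform_limit K f l F)"
proof (intro iffI conjI allI impI)
  assume lim: "limitin (Hol_topology \<Omega>) f l F"
  show l: "l \<in> Hol \<Omega>"
    using limitin_topspace[OF lim] by simp
  show "\<forall>\<^sub>F x in F. f x \<in> Hol \<Omega>"
    using lim l openin_topspace[of "Hol_topology \<Omega>"] by (simp add: limitin_def)
  fix K assume K: "compact K \<and> K \<subseteq> \<Omega>"
  show "uniform_limit K f l F"
  proof (rule uniform_limitI)
    fix e :: real assume e: "e > 0"
    define U where "U = {g \<in> Hol \<Omega>. \<exists>d<e. \<forall>z\<in>K. dist (g z) (l z) \<le> d}"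
    have "Hol_open \<Omega> U"
    proof (rule Hol_openI)
      show "U \<subseteq> Hol \<Omega>" by (auto simp: U_def)
      fix g assume "g \<in> U"
      then obtain d where d: "d < e" "\<forall>z\<in>K. dist (g z) (l z) \<le> d"
        by (auto simp: U_def)
      have "h \<in> U" if h: "h \<in> Hol \<Omega>" "\<forall>z\<in>K. dist (h z) (g z) < (e - d) / 2" for h
      proof -
        have "dist (h z) (l z) \<le> (e + d) / 2" if z: "z \<in> K" for z
        proof -
          have "dist (h z) (l z) \<le> dist (h z) (g z) + dist (g z) (l z)"
            by (rule dist_triangle)
          moreover have "dist (h z) (g z) < (e - d) / 2" "dist (g z) (l z) \<le> d"
            using h d z by auto
          ultimately show ?thesis by argo
        qed
        moreover have "(e + d) / 2 < e" using d(1) by simp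
        ultimately show ?thesis using h(1) unfolding U_def by blast
      qed
      moreover have "(e - d) / 2 > 0" using d(1) by simp
      ultimately show "\<exists>K e. compact K \<and> K \<subseteq> \<Omega> \<and> e > 0 \<and>
          (\<forall>h \<in> Hol \<Omega>. (\<forall>z\<in>K. dist (h z) (g z) < e) \<longrightarrow> h \<in> U)"
        using K by (intro exI[of _ K] exI[of _ "(e - d) / 2"]) simp
    qed
    moreover have "l \<in> U"
      using l e by (auto simp: U_def intro!: exI[of _ 0])
    ultimately have "\<forall>\<^sub>F x in F. f x \<in> U"
      using lim by (simp add: limitin_def openin_Hol_topology)
    then show "\<forall>\<^sub>F x in F. \<forall>z\<in>K. dist (f x z) (l z) < e"
      by (rule eventually_mono) (auto simp: U_def intro: le_less_trans)
  qed
next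
  assume R: "l \<in> Hol \<Omega> \<and> (\<forall>\<^sub>F x in F. f x \<in> Hol \<Omega>) \<and>
     (\<forall>K. compact K \<and> K \<subseteq> \<Omega> \<longrightarrow> uniform_limit K f l F)"
  show "limitin (Hol_topology \<Omega>) f l F"
    unfolding limitin_def
  proof (intro conjI allI impI)
    show "l \<in> topspace (Hol_topology \<Omega>)" using R by simp
    fix U assume "openin (Hol_topology \<Omega>) U \<and> l \<in> U"
    then have U: "Hol_open \<Omega> U" "l \<in> U" by (simp_all add: openin_Hol_topology)
    obtain K e where K: "compact K" "K \<subseteq> \<Omega>" "e > 0"
        "\<forall>g \<in> Hol \<Omega>. (\<forall>z\<in>K. dist (g z) (l z) < e) \<longrightarrow> g \<in> U"
      using Hol_openD[OF U] by (elim exE conjE)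
    have "uniform_limit K f l F" using R K(1,2) by simp
    then have "\<forall>\<^sub>F x in F. \<forall>z\<in>K. dist (f x z) (l z) < e"
      using K(3) by (rule uniform_limitD)
    moreover have "\<forall>\<^sub>F x in F. f x \<in> Hol \<Omega>" using R by simp
    ultimately show "\<forall>\<^sub>F x in F. f x \<in> U"
      by eventually_elim (simp add: K(4))
  qed
qed

lemma T_tilde_in_Hol:
  assumes "open \<Omega>" "f \<in> Hol \<Omega>"
  shows "T_tilde \<Omega> N f \<in> Hol \<Omega>"
proof -
  have f: "f holomorphic_on \<Omega>" using assms(2) by (simp add: Hol_def)
  have "(\<lambda>\<zeta>. \<Sum>n=0..N. (deriv ^^ n) f \<zeta> / fact n * (- \<zeta>) ^ n) holomorphic_on \<Omega>"
    by (intro holomorphic_on_sum holomorphic_on_mult holomorphic_on_divide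
        holomorphic_on_power holomorphic_on_minus holomorphic_on_ident holomorphic_on_const
        holomorphic_higher_deriv[OF f assms(1)]) simp
  then have "T_tilde \<Omega> N f holomorphic_on \<Omega>"
    by (rule holomorphic_transform) (simp add: T_tilde_def)
  then show ?thesis by (simp add: Hol_def T_tilde_def)
qed

end

theory Submission
  imports Defs
begin

text \<open>
  For each fixed point of \<open>\<Omega>\<close> and each \<open>N\<close>, evaluation of \<open>T\<^sub>N f\<close> there is continuous in \<open>f\<close> by
  Cauchy's inequality; this gives the \<open>G\<^sub>\<delta>\<close> property. For density no category argument is needed:
  it suffices to have one \<open>h\<close> for which every \<open>T\<^sub>N h\<close> is unbounded, because for each \<open>N\<close> at most
  one parameter \<open>t\<close> makes \<open>T\<^sub>N (f + t h)\<close> bounded, so arbitrarily small good \<open>t\<close> remain.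
  If \<open>\<Omega>\<close> has a boundary point \<open>b\<close>, then \<open>h z = 1 / (z - b)\<close> works. If \<open>\<Omega>\<close> is the whole plane, then
  \<open>h = exp\<close> works: a bounded \<open>T\<^sub>N exp\<close> would be constant by Liouville, but its derivative is
  \<open>exp z (-z)\<^sup>N / N!\<close>.
\<close>

section \<open>Locality, linearity and a Cauchy estimate for the Taylor sums\<close>

lemma T_tilde_cong:
  assumes "open \<Omega>" "f holomorphic_on \<Omega>" "\<And>z. z \<in> \<Omega> \<Longrightarrow> f z = g z"
  shows "T_tilde \<Omega> N f = T_tilde \<Omega> N g"
proof -
  have "g holomorphic_on \<Omega>"
    using assms(2) by (rule holomorphic_transform) (simp add: assms(3))
  then have "(deriv ^^ n) f \<zeta> = (deriv ^^ n) g \<zeta>" if "\<zeta> \<in> \<Omega>" for n \<zeta>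
    using higher_deriv_transform_within_open assms that by metis
  then show ?thesis
    by (simp add: T_tilde_def fun_eq_iff restrict_def)
qed

lemma T_tilde_add_cmult:
  assumes "open \<Omega>" "f holomorphic_on \<Omega>" "g holomorphic_on \<Omega>" "\<zeta> \<in> \<Omega>"
  shows "T_tilde \<Omega> N (\<lambda>z. f z + c * g z) \<zeta> = T_tilde \<Omega> N f \<zeta> + c * T_tilde \<Omega> N g \<zeta>"
proof -
  have "(deriv ^^ n) (\<lambda>z. f z + c * g z) \<zeta> = (deriv ^^ n) f \<zeta> + c * (deriv ^^ n) g \<zeta>" for n
  proof -
    have "(\<lambda>z. c * g z) holomorphic_on \<Omega>"
      using assms(3) by (intro holomorphic_intros)
    then show ?thesis
      using higher_deriv_add[OF assms(2) _ assms(1,4)]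
        higher_deriv_cmult[OF assms(3,4,1)] by simp
  qed
  then show ?thesis
    using assms(4)
    by (simp add: T_tilde_def sum_distrib_left add_divide_distrib ring_distribs
        mult.assoc flip: sum.distrib)
qed

text \<open>Cauchy's inequality on the disc of radius \<open>r\<close> bounds the
  \<open>n\<close>-th Taylor coefficient at \<zeta> by \<open>B / r ^ n\<close>. The remaining
  factor depends on \<zeta>, \<open>r\<close> and \<open>N\<close> but not on \<open>f\<close>, so
  evaluating the sum at \<zeta> is continuous for uniform convergence on that disc.\<close>

lemma T_tilde_norm_le:
  assumes "f holomorphic_on \<Omega>" "cball \<zeta> r \<subseteq> \<Omega>" "r > 0"
    and B: "\<And>z. z \<in> cball \<zeta> r \<Longrightarrow> norm (f z) \<le> B"
  shows "norm (T_tilde \<Omega> N f \<zeta>) \<le> B * (\<Sum>n=0..N. (norm \<zeta> / r) ^ n)"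
proof -
  have \<zeta>: "\<zeta> \<in> \<Omega>"
    using assms(2,3) by auto
  have hol: "f holomorphic_on cball \<zeta> r"
    using assms(1,2) by (rule holomorphic_on_subset)
  have "norm ((deriv ^^ n) f \<zeta> / fact n * (- \<zeta>) ^ n) \<le> B * (norm \<zeta> / r) ^ n" for n
  proof -
    have "norm ((deriv ^^ n) f \<zeta>) \<le> fact n * B / r ^ n"
    proof (rule Cauchy_inequality)
      show "f holomorphic_on ball \<zeta> r"
        using hol by (rule holomorphic_on_subset) auto
      show "continuous_on (cball \<zeta> r) f"
        using hol by (rule holomorphic_on_imp_continuous_on)
    qed (auto intro!: B assms(3) simp: dist_norm)
    then have "norm ((deriv ^^ n) f \<zeta>) / fact n * norm \<zeta> ^ n
        \<le> (fact n * B / r ^ n) / fact n * norm \<zeta> ^ n"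
      by (intro mult_right_mono divide_right_mono) auto
    then show ?thesis
      by (simp add: norm_mult norm_divide norm_power power_divide)
  qed
  then show ?thesis
    using \<zeta> by (auto simp: T_tilde_def sum_distrib_left intro!: sum_norm_le)
qed

section \<open>The G-delta property\<close>

lemma openin_Hol_T_tilde_gt:
  assumes "open \<Omega>"
  shows "openin (Hol_topology \<Omega>) {f \<in> Hol \<Omega>. \<exists>\<zeta>\<in>\<Omega>. norm (T_tilde \<Omega> N f \<zeta>) > M}"
  unfolding openin_Hol_topology
proof (rule Hol_openI)
  fix f assume "f \<in> {f \<in> Hol \<Omega>. \<exists>\<zeta>\<in>\<Omega>. norm (T_tilde \<Omega> N f \<zeta>) > M}"
  then obtain \<zeta> where f: "f \<in> Hol \<Omega>" and \<zeta>: "\<zeta> \<in> \<Omega>" "norm (T_tilde \<Omega> N f \<zeta>) > M"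
    by auto
  obtain r where r: "r > 0" "cball \<zeta> r \<subseteq> \<Omega>"
    using \<open>open \<Omega>\<close> \<zeta>(1) open_contains_cball by blast
  define S where "S = (\<Sum>n=0..N. (norm \<zeta> / r) ^ n)"
  have "S \<ge> 0"
    using r by (auto simp: S_def intro!: sum_nonneg)
  \<comment> \<open>A perturbation of size \<open>e\<close> on the disc moves the value at \<zeta>
    by at most \<open>e * S\<close>. Dividing the gap by \<open>S + 1\<close> is legitimate from
    \<open>S \<ge> 0\<close> alone and keeps this strictly below the gap.\<close>
  define e where "e = (norm (T_tilde \<Omega> N f \<zeta>) - M) / (S + 1)"
  have "e > 0"
    using \<zeta> \<open>S \<ge> 0\<close> by (simp add: e_def)
  have eS: "e * S < norm (T_tilde \<Omega> N f \<zeta>) - M"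
    using \<open>e > 0\<close> \<open>S \<ge> 0\<close> by (simp add: e_def field_simps \<zeta>(2))
  have "norm (T_tilde \<Omega> N g \<zeta>) > M"
    if g: "g \<in> Hol \<Omega>" "\<forall>z\<in>cball \<zeta> r. dist (g z) (f z) < e" for g
  proof -
    have hol: "f holomorphic_on \<Omega>" "g holomorphic_on \<Omega>"
      using f g by (auto simp: Hol_def)
    have "norm (T_tilde \<Omega> N (\<lambda>z. g z + (-1) * f z) \<zeta>) \<le> e * S"
      unfolding S_def
      by (rule T_tilde_norm_le) (use g r in \<open>auto intro!: holomorphic_intros hol less_imp_le simp: dist_norm\<close>)
    then have "norm (T_tilde \<Omega> N g \<zeta> - T_tilde \<Omega> N f \<zeta>) \<le> e * S"
      using T_tilde_add_cmult[OF \<open>open \<Omega>\<close> hol(2,1) \<zeta>(1), of N "-1"] by simp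
    then show ?thesis
      using eS norm_triangle_ineq2[of "T_tilde \<Omega> N f \<zeta>" "T_tilde \<Omega> N g \<zeta>"]
      by (simp add: norm_minus_commute)
  qed
  then show "\<exists>K e. compact K \<and> K \<subseteq> \<Omega> \<and> e > 0 \<and>
      (\<forall>g\<in>Hol \<Omega>. (\<forall>z\<in>K. dist (g z) (f z) < e) \<longrightarrow>
         g \<in> {f \<in> Hol \<Omega>. \<exists>\<zeta>\<in>\<Omega>. norm (T_tilde \<Omega> N f \<zeta>) > M})"
    using r \<open>e > 0\<close> \<zeta>(1) by (intro exI[of _ "cball \<zeta> r"] exI[of _ e]) auto
qed auto

lemma gdelta_in_Hol_T_tilde_unbounded:
  assumes "open \<Omega>"
  shows "gdelta_in (Hol_topology \<Omega>) {f \<in> Hol \<Omega>. \<forall>N. \<not> bounded (T_tilde \<Omega> N f ` \<Omega>)}"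
proof -
  \<comment> \<open>Testing only natural bounds \<open>m\<close> keeps the family of open sets
    countable: it is indexed by pairs of naturals.\<close>
  define U where
    "U = (\<lambda>(N, m). {f \<in> Hol \<Omega>. \<exists>\<zeta>\<in>\<Omega>. norm (T_tilde \<Omega> N f \<zeta>) > real m})"
  have bdd: "bounded (T_tilde \<Omega> N f ` \<Omega>) \<longleftrightarrow> (\<exists>m. \<forall>\<zeta>\<in>\<Omega>. norm (T_tilde \<Omega> N f \<zeta>) \<le> real m)" for N f
  proof
    assume "bounded (T_tilde \<Omega> N f ` \<Omega>)"
    then obtain B where B: "\<And>\<zeta>. \<zeta> \<in> \<Omega> \<Longrightarrow> norm (T_tilde \<Omega> N f \<zeta>) \<le> B"
      by (auto simp: bounded_iff)
    obtain m where "B \<le> real m"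
      using real_arch_simple by blast
    then show "\<exists>m. \<forall>\<zeta>\<in>\<Omega>. norm (T_tilde \<Omega> N f \<zeta>) \<le> real m"
      using B order_trans by blast
  qed (auto simp: bounded_iff)
  have "f \<in> {f \<in> Hol \<Omega>. \<forall>N. \<not> bounded (T_tilde \<Omega> N f ` \<Omega>)} \<longleftrightarrow> f \<in> \<Inter> (range U)" for f
    unfolding mem_Collect_eq bdd by (simp add: U_def not_le)
  then have "{f \<in> Hol \<Omega>. \<forall>N. \<not> bounded (T_tilde \<Omega> N f ` \<Omega>)} = \<Inter> (range U)"
    by (rule set_eqI)
  moreover have "gdelta_in (Hol_topology \<Omega>) (\<Inter> (range U))"
  proof (rule gdelta_in_Inter)
    fix S assume "S \<in> range U"
    then show "gdelta_in (Hol_topology \<Omega>) S"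
      using openin_Hol_T_tilde_gt[OF assms] by (auto simp: U_def intro: open_imp_gdelta_in)
  qed simp_all
  ultimately show ?thesis by simp
qed

section \<open>Unboundedness near a boundary point\<close>

lemma higher_deriv_inverse_diff:
  fixes b z :: complex
  assumes "z \<noteq> b"
  shows "(deriv ^^ n) (\<lambda>w. inverse (w - b)) z = (-1) ^ n * fact n / (z - b) ^ Suc n"
  using assms
proof (induction n arbitrary: z)
  case 0
  then show ?case by (simp add: field_simps)
next
  case (Suc n)
  \<comment> \<open>The formula is needed on a neighbourhood of \<open>z\<close>, not just at
    \<open>z\<close>, before it can be differentiated once more; the points other than
    \<open>b\<close> form an open set.\<close>
  have "\<forall>\<^sub>F w in nhds z. (deriv ^^ n) (\<lambda>w. inverse (w - b)) w = (-1) ^ n * fact n / (w - b) ^ Suc n"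
    using t1_space_nhds[OF Suc.prems] by eventually_elim (rule Suc.IH)
  then have "(deriv ^^ Suc n) (\<lambda>w. inverse (w - b)) z
      = deriv (\<lambda>w. (-1) ^ n * fact n / (w - b) ^ Suc n) z"
    by (simp add: deriv_cong_ev)
  also have "\<dots> = - ((-1) ^ n * fact n * (of_nat (Suc n) * (z - b) ^ n)) /
      ((z - b) ^ Suc n * (z - b) ^ Suc n)"
    by (rule DERIV_imp_deriv)
      (use Suc.prems in \<open>auto intro!: derivative_eq_intros simp del: power_Suc of_nat_Suc\<close>)
  also have "\<dots> = (-1) ^ Suc n * fact (Suc n) / (z - b) ^ Suc (Suc n)"
    using Suc.prems by (simp add: mult_ac)
  finally show ?case .
qed

lemma T_tilde_inverse_diff:
  assumes "\<zeta> \<in> \<Omega>" "b \<notin> \<Omega>"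
  shows "T_tilde \<Omega> N (\<lambda>z. inverse (z - b)) \<zeta> = (\<Sum>n=0..N. \<zeta> ^ n / (\<zeta> - b) ^ Suc n)"
proof -
  have "\<zeta> \<noteq> b" using assms by auto
  then show ?thesis
    using assms(1)
    by (simp add: T_tilde_def higher_deriv_inverse_diff flip: power_mult_distrib)
qed

text \<open>If \<open>f\<close> were bounded, \<open>g x * f x\<close> would tend to 0 along with
  \<open>g\<close>, contradicting uniqueness of limits. It serves to detect a pole at
  \<open>b\<close> when \<open>b\<close> is only approached from within \<open>S\<close>.\<close>

lemma unbounded_if_mult_tendsto_nonzero:
  fixes f g :: "'a::topological_space \<Rightarrow> complex"
  assumes "(g \<longlongrightarrow> 0) (at b within S)" "((\<lambda>x. g x * f x) \<longlongrightarrow> c) (at b within S)" "c \<noteq> 0"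
    and "at b within S \<noteq> bot"
  shows "\<not> bounded (f ` S)"
proof
  assume "bounded (f ` S)"
  then obtain B where B: "\<And>x. x \<in> S \<Longrightarrow> norm (f x) \<le> B"
    by (auto simp: bounded_iff)
  have "((\<lambda>x. g x * f x) \<longlongrightarrow> 0) (at b within S)"
  proof (rule Lim_null_comparison)
    show "\<forall>\<^sub>F x in at b within S. norm (g x * f x) \<le> norm (g x) * B"
      unfolding eventually_at_topological
      by (rule exI[of _ UNIV]) (auto simp: norm_mult intro!: mult_left_mono B)
    show "((\<lambda>x. norm (g x) * B) \<longlongrightarrow> 0) (at b within S)"
      by (intro tendsto_mult_left_zero tendsto_norm_zero assms)
  qed
  then show False
    using tendsto_unique[OF assms(4) assms(2)] assms(3) by blast
qed

text \<open>The sum is a rational function whose only pole is at \<open>b\<close>. If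
  \<open>b = 0\<close>, every summand equals \<open>1 / x\<close> and the pole is simple with
  residue \<open>N + 1\<close>. Otherwise the summand \<open>n = N\<close> dominates and the pole
  has order \<open>N + 1\<close>.\<close>

lemma T_tilde_inverse_diff_unbounded:
  assumes "open \<Omega>" "b \<in> frontier \<Omega>"
  shows "\<not> bounded (T_tilde \<Omega> N (\<lambda>z. inverse (z - b)) ` \<Omega>)"
proof -
  have b: "b \<notin> \<Omega>" "b \<in> closure \<Omega>"
    using assms by (auto simp: frontier_def interior_open)
  then have nontriv: "at b within \<Omega> \<noteq> bot"
    by (auto simp: trivial_limit_within closure_def)
  let ?F = "T_tilde \<Omega> N (\<lambda>z. inverse (z - b))"
  have in\<Omega>: "\<forall>\<^sub>F x in at b within \<Omega>. x \<in> \<Omega>"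
    by (auto simp: eventually_at_topological)
  show ?thesis
  proof (cases "b = 0")
    case True
    have "\<forall>\<^sub>F x in at b within \<Omega>. x * ?F x = of_nat (Suc N)"
      using in\<Omega>
    proof eventually_elim
      case (elim x)
      then have "x \<noteq> 0" using b True by auto
      then show ?case
        using T_tilde_inverse_diff[OF elim b(1)] True by (simp add: algebra_simps add_divide_distrib)
    qed
    then have lim: "((\<lambda>x. x * ?F x) \<longlongrightarrow> of_nat (Suc N)) (at b within \<Omega>)"
      by (rule tendsto_eventually)
    show ?thesis
      by (rule unbounded_if_mult_tendsto_nonzero[OF _ lim _ nontriv])
        (use True in \<open>auto simp del: of_nat_Suc intro!: tendsto_eq_intros\<close>)
  next
    case False
    \<comment> \<open>Multiplying the sum by \<open>(x - b) ^ Suc N\<close> clears all denominators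
      and leaves this polynomial. At \<open>b\<close> only the summand \<open>n = N\<close>
      survives, where the power of \<open>x - b\<close> has exponent 0 and equals 1.\<close>
    define p where "p x = (\<Sum>n=0..N. x ^ n * (x - b) ^ (N - n))" for x
    have "p b = (\<Sum>n=0..N. if n = N then b ^ N else 0)"
      unfolding p_def by (rule sum.cong) auto
    then have "p b = b ^ N" by simp
    have "continuous_on UNIV p"
      unfolding p_def by (intro continuous_intros)
    then have p: "(p \<longlongrightarrow> b ^ N) (at b within \<Omega>)"
      using \<open>p b = b ^ N\<close> by (metis UNIV_I continuous_on_def subset_UNIV tendsto_within_subset)
    have "\<forall>\<^sub>F x in at b within \<Omega>. p x = (x - b) ^ Suc N * ?F x"
      using in\<Omega>
    proof eventually_elim
      case (elim x)
      then have x: "x - b \<noteq> 0" using b by auto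
      have "x ^ n * (x - b) ^ (N - n) = (x - b) ^ Suc N * (x ^ n / (x - b) ^ Suc n)"
        if "n \<le> N" for n
      proof -
        have "(x - b) ^ Suc N = (x - b) ^ (N - n) * (x - b) ^ Suc n"
          using that by (simp flip: power_add)
        then show ?thesis
          using x by (simp del: power_Suc)
      qed
      then show ?case
        by (simp add: p_def T_tilde_inverse_diff[OF elim b(1)] sum_distrib_left del: power_Suc)
    qed
    then have lim: "((\<lambda>x. (x - b) ^ Suc N * ?F x) \<longlongrightarrow> b ^ N) (at b within \<Omega>)"
      using p by (rule Lim_transform_eventually[rotated])
    show ?thesis
      by (rule unbounded_if_mult_tendsto_nonzero[OF _ lim _ nontriv])
        (use False in \<open>auto intro!: tendsto_eq_intros\<close>)
  qed
qed

section \<open>The exponential function on the whole plane\<close>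

lemma T_tilde_exp: "T_tilde UNIV N exp = (\<lambda>\<zeta>. \<Sum>n=0..N. exp \<zeta> / fact n * (- \<zeta>) ^ n)"
proof -
  have "(deriv ^^ n) exp = (exp :: complex \<Rightarrow> complex)" for n
    by (induction n) (auto intro!: DERIV_imp_deriv)
  then show ?thesis by (simp add: T_tilde_def restrict_def)
qed

text \<open>By the product rule, the derivative of each summand with \<open>n > 0\<close> is its own
  value minus... the preceding summand's value with the same sign, so the derivatives telescope and
  only the summand \<open>n = N\<close> remains.\<close>

lemma has_field_derivative_T_tilde_exp:
  "(T_tilde UNIV N exp has_field_derivative exp \<zeta> * (- \<zeta>) ^ N / fact N) (at \<zeta>)"
  unfolding T_tilde_exp
proof (induction N)
  case 0
  then show ?case by (auto intro!: derivative_eq_intros)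
next
  case (Suc N)
  have "((\<lambda>\<zeta>. exp \<zeta> / fact (Suc N) * (- \<zeta>) ^ Suc N) has_field_derivative
      exp \<zeta> * (- \<zeta>) ^ Suc N / fact (Suc N)
        - of_nat (Suc N) / fact (Suc N) * (exp \<zeta> * (- \<zeta>) ^ N)) (at \<zeta>)"
    by (auto intro!: derivative_eq_intros simp: diff_divide_distrib mult_ac
        simp del: fact_Suc power_Suc of_nat_Suc)
  moreover have "of_nat (Suc N) / fact (Suc N) = 1 / (fact N :: complex)"
    by (simp del: of_nat_Suc)
  ultimately have "((\<lambda>\<zeta>. exp \<zeta> / fact (Suc N) * (- \<zeta>) ^ Suc N) has_field_derivative
      exp \<zeta> * (- \<zeta>) ^ Suc N / fact (Suc N) - exp \<zeta> * (- \<zeta>) ^ N / fact N) (at \<zeta>)"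
    by simp
  from DERIV_add[OF Suc this] show ?case by simp
qed

lemma T_tilde_exp_unbounded: "\<not> bounded (range (T_tilde UNIV N exp))"
proof
  assume "bounded (range (T_tilde UNIV N exp))"
  moreover have "T_tilde UNIV N exp holomorphic_on UNIV"
    unfolding T_tilde_exp by (intro holomorphic_intros) auto
  ultimately obtain c where "T_tilde UNIV N exp = (\<lambda>_. c)"
    using Liouville_theorem by (fastforce simp: constant_on_def)
  \<comment> \<open>The derivative is compared with 0 at the point 1, since at the origin it
    vanishes for every \<open>N > 0\<close>.\<close>
  then have "exp 1 * (- 1) ^ N / fact N = (0 :: complex)"
    using has_field_derivative_T_tilde_exp[of N 1] DERIV_unique DERIV_const by metis
  then show False by simp
qed

section \<open>Density by perturbation along one function\<close>

lemma exists_T_tilde_unbounded: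
  assumes "open \<Omega>" "\<Omega> \<noteq> {}"
  obtains h where "h holomorphic_on \<Omega>" "\<And>N. \<not> bounded (T_tilde \<Omega> N h ` \<Omega>)"
proof (cases "\<Omega> = UNIV")
  case True
  then show ?thesis
    using that[of exp] T_tilde_exp_unbounded by (auto intro: holomorphic_intros)
next
  case False
  then obtain b where b: "b \<in> frontier \<Omega>"
    using assms frontier_not_empty by blast
  have "b \<notin> \<Omega>"
    using assms(1) b by (auto simp: frontier_def interior_open)
  then have "(\<lambda>z. inverse (z - b)) holomorphic_on \<Omega>"
    by (intro holomorphic_intros) auto
  then show ?thesis
    using that T_tilde_inverse_diff_unbounded[OF assms(1) b] by blast
qed

text \<open>Subtracting the two bounded sums eliminates \<open>f\<close> and leaves
  \<open>(s - t)\<close> times the unbounded sum of \<open>h\<close>.\<close>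

lemma T_tilde_bounded_parameter_unique:
  assumes "open \<Omega>" "f holomorphic_on \<Omega>" "h holomorphic_on \<Omega>"
    and "\<not> bounded (T_tilde \<Omega> N h ` \<Omega>)"
    and "bounded (T_tilde \<Omega> N (\<lambda>z. f z + s * h z) ` \<Omega>)"
    and "bounded (T_tilde \<Omega> N (\<lambda>z. f z + t * h z) ` \<Omega>)"
  shows "s = t"
proof (rule ccontr)
  assume "s \<noteq> t"
  obtain A B where
    A: "\<And>\<zeta>. \<zeta> \<in> \<Omega> \<Longrightarrow> norm (T_tilde \<Omega> N f \<zeta> + s * T_tilde \<Omega> N h \<zeta>) \<le> A" and
    B: "\<And>\<zeta>. \<zeta> \<in> \<Omega> \<Longrightarrow> norm (T_tilde \<Omega> N f \<zeta> + t * T_tilde \<Omega> N h \<zeta>) \<le> B"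
    using assms(5,6) by (auto simp: bounded_iff T_tilde_add_cmult[OF assms(1-3)])
  have "norm (T_tilde \<Omega> N h \<zeta>) \<le> (A + B) / norm (s - t)" if "\<zeta> \<in> \<Omega>" for \<zeta>
  proof -
    have "norm ((s - t) * T_tilde \<Omega> N h \<zeta>) \<le> A + B"
      using norm_triangle_le_diff[OF add_mono[OF A[OF that] B[OF that]]]
      by (simp add: algebra_simps)
    then show ?thesis
      using \<open>s \<noteq> t\<close> by (simp add: norm_mult pos_le_divide_eq mult.commute)
  qed
  then show False
    using assms(4) by (auto simp: bounded_iff)
qed

lemma Hol_T_tilde_unbounded_dense:
  assumes "open \<Omega>" "\<Omega> \<noteq> {}"
  shows "Hol_topology \<Omega> closure_of {f \<in> Hol \<Omega>. \<forall>N. \<not> bounded (T_tilde \<Omega> N f ` \<Omega>)}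
    = topspace (Hol_topology \<Omega>)"
  unfolding dense_intersects_open
proof (intro allI impI)
  fix U assume "openin (Hol_topology \<Omega>) U \<and> U \<noteq> {}"
  then obtain f where U: "Hol_open \<Omega> U" and f: "f \<in> U"
    by (auto simp: openin_Hol_topology)
  obtain K e where K: "compact K" "K \<subseteq> \<Omega>" "e > 0"
    "\<And>g. g \<in> Hol \<Omega> \<Longrightarrow> \<forall>z\<in>K. dist (g z) (f z) < e \<Longrightarrow> g \<in> U"
    using Hol_openD[OF U f] by blast
  have hol_f: "f holomorphic_on \<Omega>"
    using U f by (auto simp: Hol_open_def Hol_def)
  obtain h where hol_h: "h holomorphic_on \<Omega>" and h: "\<And>N. \<not> bounded (T_tilde \<Omega> N h ` \<Omega>)"
    using exists_T_tilde_unbounded[OF assms] by blast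
  have "continuous_on K h"
    using hol_h K(2) holomorphic_on_imp_continuous_on holomorphic_on_subset by blast
  then have "bounded (h ` K)"
    using K(1) by (intro compact_imp_bounded compact_continuous_image)
  then obtain B where B: "B > 0" "\<And>z. z \<in> K \<Longrightarrow> norm (h z) \<le> B"
    by (auto simp: bounded_pos)
  define g where "g = (\<lambda>t::real. \<lambda>z. f z + of_real t * h z)"
  have hol_g: "g t holomorphic_on \<Omega>" for t
    unfolding g_def by (intro holomorphic_intros hol_f hol_h)
  define bad where "bad N = {t. bounded (T_tilde \<Omega> N (g t) ` \<Omega>)}" for N
  have "countable (bad N)" for N
  proof -
    have "s = t" if "s \<in> bad N" "t \<in> bad N" for s t
      using T_tilde_bounded_parameter_unique[OF assms(1) hol_f hol_h h, of N "of_real s" "of_real t"] that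
      by (simp add: bad_def g_def)
    then have "bad N = {} \<or> (\<exists>t. bad N = {t})" by blast
    then show ?thesis by auto
  qed
  then have "countable (\<Union>N. bad N)" by auto
  \<comment> \<open>For \<open>t\<close> below \<open>e / B\<close> the perturbation
    \<open>t * h\<close> stays below \<open>e\<close> on \<open>K\<close>. Each \<open>N\<close>
    excludes at most one \<open>t\<close>, so countably many exclusions cannot exhaust the interval,
    and one \<open>t\<close> serves all \<open>N\<close> at once.\<close>
  moreover have "uncountable {0<..<e / B}"
    using K(3) B(1) by (simp add: uncountable_open_interval)
  ultimately obtain t where t: "0 < t" "t < e / B" and good: "\<And>N. t \<notin> bad N"
    using countable_subset[of "{0<..<e / B}" "\<Union>N. bad N"] by fastforce
  \<comment> \<open>Elements of \<open>Hol \<Omega>\<close> must be \<open>undefined\<close> outside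
    \<Omega>, so \<open>g t\<close> is restricted; derivatives at points of the open set \<Omega> do
    not notice this.\<close>
  have eq: "T_tilde \<Omega> N (restrict (g t) \<Omega>) = T_tilde \<Omega> N (g t)" for N
    using T_tilde_cong[OF assms(1) hol_g] by (metis restrict_apply')
  have mem: "restrict (g t) \<Omega> \<in> Hol \<Omega>"
    using hol_g[of t] by (auto simp: Hol_def cong: holomorphic_cong)
  have "restrict (g t) \<Omega> \<in> U"
  proof (rule K(4)[OF mem], rule ballI)
    fix z assume z: "z \<in> K"
    have "t * norm (h z) \<le> t * B"
      using B(2)[OF z] t(1) by (intro mult_left_mono) auto
    also have "\<dots> < e"
      using t(2) B(1) by (simp add: field_simps)
    finally show "dist (restrict (g t) \<Omega> z) (f z) < e"
      using z K(2) t(1) by (auto simp: g_def dist_norm norm_mult)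
  qed
  then show "{f \<in> Hol \<Omega>. \<forall>N. \<not> bounded (T_tilde \<Omega> N f ` \<Omega>)} \<inter> U \<noteq> {}"
    using mem good by (auto simp: bad_def eq)
qed

theorem mainTheorem4:
  fixes \<Omega> :: "complex set"
  assumes "open \<Omega>" and "connected \<Omega>" and "\<Omega> \<noteq> {}"
  shows "gdelta_in (Hol_topology \<Omega>)
           {f \<in> Hol \<Omega>. \<forall>N. \<not> bounded (T_tilde \<Omega> N f ` \<Omega>)} \<and>
         Hol_topology \<Omega> closure_of
           {f \<in> Hol \<Omega>. \<forall>N. \<not> bounded (T_tilde \<Omega> N f ` \<Omega>)} = topspace (Hol_topology \<Omega>)"
  using gdelta_in_Hol_T_tilde_unbounded[OF assms(1)]
    Hol_T_tilde_unbounded_dense[OF assms(1,3)] ..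

end
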